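(* Let $n\geq 2$ and $q=p^h$ with $p$ prime and $h\geq 1$. The minimum weight of the code $C\cap C^\perp$, where $C=C(PG(n,q))$, is equal to $2q^{n-1}$. This weight is attained by $H_1-H_2$, the difference of the incidence vectors of two distinct hyperplanes $H_1,H_2$ of $PG(n,q)$.
   Context: $PG(n,q)$ is the Desarguesian $n$-dimensional projective space over $\mathbb{F}_q$. The code $C=C(PG(n,q))$ is the $\mathbb{F}_p$-linear span, inside $\mathbb{F}_p^{\theta_n}$ with $\theta_n=(q^{n+1}-1)/(q-1)$, of the rows of the incidence matrix whose rows are indexed by the hyperplanes and whose columns are indexed by the points of $PG(n,q)$. A row has entry $1$ if the point lies in the hyperplane and $0$ otherwise. $C^\perp$ is its dual with respect to the standard scalar product over $\mathbb{F}_p$. The weight of a vector is the size of its support, the set of nonzero coordinates, which is identified with a set of points. *)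

theory Defs
  imports "HOL-Computational_Algebra.Primes"
begin

definition pvecs :: "nat \<Rightarrow> (nat \<Rightarrow> 'a::field) set" where
  "pvecs n = {v. \<forall>i>n. v i = 0}"

definition pg_points :: "nat \<Rightarrow> (nat \<Rightarrow> 'a::field) set set" where
  "pg_points n = {{(\<lambda>i. c * v i) | c. True} | v. v \<in> pvecs n \<and> v \<noteq> (\<lambda>_. 0)}"

definition pg_hyperplanes :: "nat \<Rightarrow> (nat \<Rightarrow> 'a::field) set set set" where
  "pg_hyperplanes n = {{P \<in> pg_points n. \<forall>v\<in>P. (\<Sum>i\<le>n. a i * v i) = 0} | a. a \<in> pvecs n \<and> a \<noteq> (\<lambda>_. 0)}"

definition fp_vecs :: "nat \<Rightarrow> nat \<Rightarrow> ((nat \<Rightarrow> 'a::field) set \<Rightarrow> int) set" where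
  "fp_vecs p n = {f. (\<forall>P. P \<notin> pg_points n \<longrightarrow> f P = 0) \<and> (\<forall>P. 0 \<le> f P \<and> f P < int p)}"

definition incvec :: "nat \<Rightarrow> (nat \<Rightarrow> 'a::field) set set \<Rightarrow> (nat \<Rightarrow> 'a) set \<Rightarrow> int" where
  "incvec n H = (\<lambda>P. if P \<in> pg_points n \<and> P \<in> H then 1 else 0)"

definition code_C :: "nat \<Rightarrow> nat \<Rightarrow> ((nat \<Rightarrow> 'a::field) set \<Rightarrow> int) set" where
  "code_C p n = {f. \<exists>c :: (nat \<Rightarrow> 'a) set set \<Rightarrow> int. \<forall>P.
      f P = (if P \<in> pg_points n
             then (\<Sum>H\<in>pg_hyperplanes n. c H * incvec n H P) mod int p else 0)}"

definition code_dual :: "nat \<Rightarrow> nat \<Rightarrow> ((nat \<Rightarrow> 'a::field) set \<Rightarrow> int) set" where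
  "code_dual p n = {f \<in> fp_vecs p n. \<forall>g \<in> code_C p n.
      (\<Sum>P\<in>pg_points n. f P * g P) mod int p = 0}"

definition weight :: "nat \<Rightarrow> ((nat \<Rightarrow> 'a::field) set \<Rightarrow> int) \<Rightarrow> nat" where
  "weight n f = card {P \<in> pg_points n. f P \<noteq> 0}"

end

theory Submission
  imports Defs "HOL-Library.Cardinality" "HOL-Library.Function_Algebras" "HOL-Computational_Algebra.Polynomial"
begin

text \<open>
  Over the field, the incidence vector of the hyperplane \<open>a \<bullet> v = 0\<close> is \<open>1 - (a \<bullet> v)^(q - 1)\<close>. Two
  hyperplanes meet in \<open>1\<close> modulo \<open>p\<close> points, so orthogonality of a word \<open>\<Sum> c\<^sub>H H\<close> to a single
  hyperplane forces \<open>\<Sum> c\<^sub>H = 0\<close>; hence a word of the hull is given by a form \<open>F\<close> of degree \<open>q - 1\<close>.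
  Let \<open>U\<close> be a maximal linear subspace on which \<open>F\<close> vanishes. By maximality \<open>F\<close> is not identically
  zero on any coset \<open>w + U\<close> with \<open>w \<notin> U\<close>, and there it is a polynomial of degree at most \<open>q - 2\<close>,
  because its part of degree \<open>q - 1\<close> is \<open>F\<close> restricted to \<open>U\<close>. Along a direction on which its leading
  form does not vanish, every line of the coset carries at least two nonzeros. Summing over the cosets and
  using \<open>q |U| \<le> |V|\<close> gives the bound.
\<close>

section \<open>Counting over a finite field\<close>

text \<open>Multiplication by \<open>x\<close> permutes the nonzero elements, so it leaves their
  product unchanged.\<close>

lemma power_card_minus_one:
  fixes x :: "'a::{finite,field}"
  assumes "x \<noteq> 0"
  shows "x ^ (CARD('a) - 1) = 1"
proof -
  have "(\<Prod>y\<in>UNIV-{0}. x * y) = \<Prod>(UNIV-{0})"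
    by (rule prod.reindex_bij_witness[of _ "\<lambda>y. y / x" "\<lambda>y. x * y"]) (use assms in auto)
  moreover have "(\<Prod>y\<in>UNIV-{0}. x * y) = x ^ (CARD('a) - 1) * \<Prod>(UNIV-{0})"
    by (simp add: prod.distrib)
  ultimately show ?thesis
    by simp
qed

text \<open>The shift by 1 permutes the field, so adding 1 to each summand leaves the sum over the
  field unchanged.\<close>

lemma of_nat_card_eq_0: "of_nat CARD('a::{finite,field}) = (0 :: 'a)"
proof -
  have "(\<Sum>x\<in>(UNIV :: 'a set). x + 1) = \<Sum>UNIV"
    by (rule sum.reindex_bij_witness[of _ "\<lambda>y. y - 1" "\<lambda>y. y + 1"]) auto
  then show ?thesis
    by (simp add: sum.distrib)
qed

lemma card_UNIV_field_gt_1: "CARD('a::{finite,field}) > 1"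
  using card_mono[of UNIV "{0, 1 :: 'a}"] by simp

text \<open>\<open>W\<close> is the direct sum of the line through \<open>w\<close> and the kernel
  of \<open>\<phi>\<close> on \<open>W\<close>.\<close>

lemma card_subspace_kernel:
  fixes s :: "'a::{finite,field} \<Rightarrow> 'b::ab_group_add \<Rightarrow> 'b"
  assumes lin: "Vector_Spaces.linear s (*) \<phi>" and W: "module.subspace s W"
    and w: "w \<in> W" "\<phi> w \<noteq> 0"
  shows "card W = CARD('a) * card {v \<in> W. \<phi> v = 0}"
proof -
  interpret Vector_Spaces.linear s "(*)" \<phi> by (rule lin)
  have "bij_betw (\<lambda>(t, v). v + s t w) (UNIV \<times> {v \<in> W. \<phi> v = 0}) W"
    by (rule bij_betw_byWitness[where f' = "\<lambda>x. (\<phi> x / \<phi> w, x - s (\<phi> x / \<phi> w) w)"])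
      (use w W in \<open>auto simp: add diff scale vs1.subspace_add vs1.subspace_scale vs1.subspace_diff\<close>)
  then have "card W = card ((UNIV :: 'a set) \<times> {v \<in> W. \<phi> v = 0})"
    by (simp add: bij_betw_same_card)
  then show ?thesis
    by (simp add: card_cartesian_product)
qed

section \<open>Nonzeros of sums of powers of linear forms\<close>

text \<open>On \<open>U\<close> the map \<open>u \<mapsto> f (w + u)\<close> has some degree
  \<open>d < m\<close>. A direction \<open>e\<close> with nonzero leading value turns it into a
  nonzero polynomial in \<open>t\<close> of degree at most \<open>d\<close> along every
  \<open>u + s t e\<close>, which leaves at least \<open>CARD('a) - d\<close> values of
  \<open>t\<close> with a nonzero.\<close>

lemma card_nonzeros_coset:
  fixes s :: "'a::{finite,field} \<Rightarrow> 'b::ab_group_add \<Rightarrow> 'b"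
    and I :: "'i set" and m :: nat and k :: "'i \<Rightarrow> 'a" and L :: "'i \<Rightarrow> 'b \<Rightarrow> 'a"
  defines "f \<equiv> \<lambda>v. \<Sum>i\<in>I. k i * L i v ^ m"
  assumes lin: "\<And>i. i \<in> I \<Longrightarrow> Vector_Spaces.linear s (*) (L i)"
    and U: "module.subspace s U" and fin: "finite U"
    and zero: "\<And>u. u \<in> U \<Longrightarrow> f u = 0"
    and y: "y \<in> U" "f (w + y) \<noteq> 0"
    and s: "vector_space s" and I: "finite I"
  shows "(CARD('a) + 1 - m) * card U \<le> CARD('a) * card {u \<in> U. f (w + u) \<noteq> 0}"
proof -
  interpret vector_space s by (rule s)
  \<comment> \<open>\<open>g j\<close> is the homogeneous component of degree \<open>j\<close> of \<open>v \<mapsto> f (w + v)\<close>; on \<open>U\<close> the one of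
    degree \<open>m\<close> is \<open>f\<close> itself, so it vanishes there.\<close>
  define g where "g = (\<lambda>j v. \<Sum>i\<in>I. k i * of_nat (m choose j) * L i w ^ (m - j) * L i v ^ j)"
  have L_add: "L i (x + z) = L i x + L i z" and L_scale: "L i (s c x) = c * L i x"
    if "i \<in> I" for i x z c
    using lin[OF that] by (simp_all add: Vector_Spaces.linear_iff)
  have expand: "f (w + v) = (\<Sum>j\<le>m. g j v)" for v
  proof -
    have "f (w + v) = (\<Sum>i\<in>I. k i * (L i v + L i w) ^ m)"
      unfolding f_def by (intro sum.cong) (auto simp: L_add add.commute)
    also have "\<dots> = (\<Sum>i\<in>I. \<Sum>j\<le>m. k i * of_nat (m choose j) * L i w ^ (m - j) * L i v ^ j)"
      by (simp add: binomial_ring sum_distrib_left mult_ac)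
    also have "\<dots> = (\<Sum>j\<le>m. g j v)"
      unfolding g_def by (rule sum.swap)
    finally show ?thesis .
  qed
  \<comment> \<open>Degrees are read off from values: a component that vanishes throughout
    \<open>U\<close> is dropped, even if it is not formally zero. So \<open>d\<close> is the largest
    degree that is visible on \<open>U\<close>.\<close>
  define J where "J = {j. j \<le> m \<and> (\<exists>u\<in>U. g j u \<noteq> 0)}"
  define d where "d = Max J"
  have "J \<noteq> {}"
  proof
    assume "J = {}"
    then have "f (w + y) = 0"
      unfolding expand using y(1) by (intro sum.neutral) (auto simp: J_def)
    with y(2) show False ..
  qed
  moreover have "finite J"
    unfolding J_def by auto
  ultimately have "d \<in> J" and above: "\<And>j. j \<in> J \<Longrightarrow> j \<le> d"
    unfolding d_def by simp_all
  then obtain e where e: "e \<in> U" "g d e \<noteq> 0" and "d \<le> m"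
    by (auto simp: J_def)
  have "g m u = 0" if "u \<in> U" for u
    using zero[OF that] by (simp add: g_def f_def)
  with e \<open>d \<le> m\<close> have "d < m"
    by (metis le_neq_implies_less)
  have line: "CARD('a) + 1 - m \<le> card {t. f (w + (u + s t e)) \<noteq> 0}" if u: "u \<in> U" for u
  proof -
    define P where "P = (\<Sum>j\<le>d. \<Sum>i\<in>I.
      smult (k i * of_nat (m choose j) * L i w ^ (m - j)) ([:L i u, L i e:] ^ j))"
    have P: "poly P t = f (w + (u + s t e))" for t
    proof -
      have "u + s t e \<in> U"
        using u e U by (simp add: subspace_add subspace_scale)
      then have "f (w + (u + s t e)) = (\<Sum>j\<le>d. g j (u + s t e))"
        unfolding expand using above \<open>d \<le> m\<close>
        by (intro sum.mono_neutral_right) (auto simp: J_def)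
      also have "\<dots> = poly P t"
        unfolding P_def g_def poly_sum
        by (intro sum.cong refl) (simp add: L_add L_scale)
      finally show ?thesis ..
    qed
    have deg: "degree (smult c ([:a, b:] ^ j)) \<le> j" for a b c :: 'a and j
      using degree_power_le[of "[:a, b:]" j] degree_smult_le[of c "[:a, b:] ^ j"]
      by (simp split: if_splits)
    have "degree P \<le> d"
      unfolding P_def using I by (intro degree_sum_le order.trans[OF deg]) auto
    \<comment> \<open>Only the summands with \<open>j = d\<close> reach degree \<open>d\<close>, and
      their top coefficients do not involve the base point \<open>u\<close>. One \<open>e\<close>
      therefore serves all lines.\<close>
    have "coeff P d = (\<Sum>j\<le>d. \<Sum>i\<in>I.
        coeff (smult (k i * of_nat (m choose j) * L i w ^ (m - j)) ([:L i u, L i e:] ^ j)) d)"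
      by (simp add: P_def coeff_sum)
    also have "\<dots> = (\<Sum>j\<in>{d}. \<Sum>i\<in>I.
        coeff (smult (k i * of_nat (m choose j) * L i w ^ (m - j)) ([:L i u, L i e:] ^ j)) d)"
      by (intro sum.mono_neutral_right ballI sum.neutral coeff_eq_0 le_less_trans[OF deg]) auto
    also have "\<dots> = g d e"
      by (simp add: coeff_linear_poly_power g_def)
    finally have "P \<noteq> 0"
      using e by auto
    then have "card {t. poly P t = 0} \<le> d"
      using card_poly_roots_bound[of P] \<open>degree P \<le> d\<close> by linarith
    moreover have "CARD('a) = card {t. poly P t = 0} + card {t. poly P t \<noteq> 0}"
      by (subst card_Un_disjoint[symmetric]) (auto intro!: arg_cong[where f = card])
    ultimately show ?thesis
      using \<open>d < m\<close> unfolding P by linarith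
  qed
  \<comment> \<open>Pairs \<open>(u, t)\<close> are counted instead of lines: translation by
    \<open>s t e\<close> permutes \<open>U\<close>, so each \<open>t\<close> contributes the same
    number. This also covers \<open>e = 0\<close>, which can occur for \<open>d = 0\<close>.\<close>
  have "(CARD('a) + 1 - m) * card U \<le> (\<Sum>u\<in>U. card {t. f (w + (u + s t e)) \<noteq> 0})"
    using sum_mono[OF line, of U "\<lambda>u. u"] by (simp add: mult.commute)
  also have "\<dots> = card {u \<in> U. f (w + u) \<noteq> 0} * card (UNIV :: 'a set)"
  proof (subst sum_multicount[symmetric, OF fin finite_class.finite_UNIV])
    show "\<forall>t\<in>UNIV. card {u \<in> U. f (w + (u + s t e)) \<noteq> 0} = card {u \<in> U. f (w + u) \<noteq> 0}"
    proof
      fix t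
      have "bij_betw (\<lambda>u. u + s t e) {u \<in> U. f (w + (u + s t e)) \<noteq> 0} {u \<in> U. f (w + u) \<noteq> 0}"
        by (rule bij_betw_byWitness[where f' = "\<lambda>u. u - s t e"])
          (use e U in \<open>auto simp: subspace_add subspace_scale subspace_diff\<close>)
      then show "card {u \<in> U. f (w + (u + s t e)) \<noteq> 0} = card {u \<in> U. f (w + u) \<noteq> 0}"
        by (rule bij_betw_same_card)
    qed
  qed simp_all
  finally show ?thesis
    by (simp add: mult.commute)
qed


text \<open>Serre's bound for the number of zeros of a form, here for sums of powers of linear forms.\<close>
lemma card_nonzeros_form:
  fixes s :: "'a::{finite,field} \<Rightarrow> 'b::ab_group_add \<Rightarrow> 'b"
    and I :: "'i set" and m :: nat and k :: "'i \<Rightarrow> 'a" and L :: "'i \<Rightarrow> 'b \<Rightarrow> 'a"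
  defines "f \<equiv> \<lambda>v. \<Sum>i\<in>I. k i * L i v ^ m"
  assumes s: "vector_space s" and I: "finite I"
    and lin: "\<And>i. i \<in> I \<Longrightarrow> Vector_Spaces.linear s (*) (L i)"
    and V: "module.subspace s V" and fin: "finite V"
    and v: "v \<in> V" "f v \<noteq> 0" and "m > 0"
  shows "(CARD('a) + 1 - m) * ((CARD('a) - 1) * card V) \<le> (CARD('a))\<^sup>2 * card {v \<in> V. f v \<noteq> 0}"
proof -
  interpret vector_space s by (rule s)
  have f_scale: "f (s c x) = c ^ m * f x" for c x
    unfolding f_def sum_distrib_left
    by (intro sum.cong refl) (use lin in \<open>auto simp: Vector_Spaces.linear_iff power_mult_distrib\<close>)
  have f_0: "f 0 = 0"
    using f_scale[of 0 0] \<open>m > 0\<close> by (simp add: power_0_left)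
  define S where "S = {U. subspace U \<and> U \<subseteq> V \<and> (\<forall>u\<in>U. f u = 0)}"
  have "finite S"
    by (rule finite_subset[of _ "Pow V"]) (use fin in \<open>auto simp: S_def\<close>)
  moreover have "{0} \<in> S"
    using V by (simp add: S_def f_0 subspace_0)
  ultimately obtain U where "U \<in> S" and maximal: "\<And>B. B \<in> S \<Longrightarrow> U \<subseteq> B \<Longrightarrow> U = B"
    using finite_has_maximal[of S] by blast
  then have U: "subspace U" "U \<subseteq> V" "\<And>u. u \<in> U \<Longrightarrow> f u = 0"
    by (auto simp: S_def)
  then have "finite U"
    using fin finite_subset by blast
  \<comment> \<open>By maximality \<open>f\<close> is nonzero at some \<open>x = s c w + u\<close>
    with \<open>u \<in> U\<close>, and \<open>c \<noteq> 0\<close> since \<open>f\<close> vanishes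
    on \<open>U\<close>. Homogeneity permits rescaling by \<open>1 / c\<close> to reach
    \<open>w + U\<close> itself.\<close>
  have nonzero: "\<exists>y\<in>U. f (w + y) \<noteq> 0" if w: "w \<in> V - U" for w
  proof -
    have "span (insert w U) \<subseteq> V"
      using w U V by (intro span_minimal) auto
    moreover have "w \<in> span (insert w U)" "U \<subseteq> span (insert w U)"
      by (auto intro: span_base)
    ultimately obtain x where x: "x \<in> span (insert w U)" "f x \<noteq> 0"
      using maximal[of "span (insert w U)"] w by (auto simp: S_def)
    then obtain c where c: "x - s c w \<in> U"
      using U by (auto simp: span_insert span_eq_iff[THEN iffD2])
    have "c \<noteq> 0"
      using c x U by auto
    then have "w + s (1 / c) (x - s c w) = s (1 / c) x"
      by (simp add: scale_right_diff_distrib)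
    moreover have "f (s (1 / c) x) \<noteq> 0"
      using x \<open>c \<noteq> 0\<close> by (simp add: f_scale)
    ultimately show ?thesis
      using c U by (metis subspace_scale)
  qed
  have coset: "(CARD('a) + 1 - m) * card U \<le> CARD('a) * card {u \<in> U. f (w + u) \<noteq> 0}"
    if w: "w \<in> V - U" for w
    using nonzero[OF w] card_nonzeros_coset[of I s L U k m _ w] lin U \<open>finite U\<close> s I
    unfolding f_def by blast
  \<comment> \<open>The sum runs over all \<open>w \<in> V - U\<close> rather than over coset
    representatives, so every coset is counted \<open>card U\<close> times; this factor cancels
    below.\<close>
  have "(CARD('a) + 1 - m) * card U * card (V - U)
      \<le> (\<Sum>w\<in>V - U. CARD('a) * card {u \<in> U. f (w + u) \<noteq> 0})"
    using sum_mono[OF coset, of "V - U" "\<lambda>w. w"] by (simp add: mult_ac)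
  also have "\<dots> = CARD('a) * (card {v \<in> V. f v \<noteq> 0} * card U)"
  proof (subst sum_distrib_left[symmetric], subst sum_multicount)
    \<comment> \<open>For fixed \<open>u\<close>, each nonzero \<open>v\<close> is
      \<open>w + u\<close> for exactly one \<open>w\<close>, and \<open>w \<notin> U\<close> because
      \<open>f\<close> vanishes on \<open>U\<close>.\<close>
    show "\<forall>u\<in>U. card {w \<in> V - U. f (w + u) \<noteq> 0} = card {v \<in> V. f v \<noteq> 0}"
    proof
      fix u assume u: "u \<in> U"
      have "x - u \<in> U \<longleftrightarrow> x \<in> U" for x
        using u U by (metis diff_add_cancel subspace_add subspace_diff)
      then have "bij_betw (\<lambda>w. w + u) {w \<in> V - U. f (w + u) \<noteq> 0} {v \<in> V. f v \<noteq> 0}"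
        by (intro bij_betw_byWitness[where f' = "\<lambda>w. w - u"])
          (use u U V in \<open>auto simp: subspace_add subspace_diff subset_iff\<close>)
      then show "card {w \<in> V - U. f (w + u) \<noteq> 0} = card {v \<in> V. f v \<noteq> 0}"
        by (rule bij_betw_same_card)
    qed
  qed (use fin \<open>finite U\<close> in auto)
  finally have "card U * ((CARD('a) + 1 - m) * card (V - U))
      \<le> card U * (CARD('a) * card {v \<in> V. f v \<noteq> 0})"
    by (simp add: mult_ac)
  moreover have "card U > 0"
    using U \<open>finite U\<close> subspace_0 card_gt_0_iff by blast
  ultimately have main: "(CARD('a) + 1 - m) * card (V - U) \<le> CARD('a) * card {v \<in> V. f v \<noteq> 0}"
    by simp
  have "v \<in> V - U"
    using v U by auto
  \<comment> \<open>The translates of \<open>U\<close> by distinct multiples of \<open>v\<close> are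
    disjoint subsets of \<open>V\<close>, which gives
    \<open>CARD('a) * card U \<le> card V\<close>.\<close>
  have "inj_on (\<lambda>(t, u). u + s t v) (UNIV \<times> U)"
  proof (clarsimp simp: inj_on_def)
    fix t t' x y assume xy: "x \<in> U" "y \<in> U" and eq: "x + s t v = y + s t' v"
    have "s (t - t') v = y - x"
      using eq by (simp add: scale_left_diff_distrib algebra_simps)
    then have "s (t - t') v \<in> U"
      using xy U by (simp add: subspace_diff)
    then have "s (1 / (t - t')) (s (t - t') v) \<in> U"
      by (rule subspace_scale[OF U(1)])
    then have "t = t'"
      using \<open>v \<in> V - U\<close> by (auto split: if_splits)
    with eq show "t = t' \<and> x = y"
      by simp
  qed
  moreover have "(\<lambda>(t, u). u + s t v) ` (UNIV \<times> U) \<subseteq> V"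
    using U V v by (auto simp: subspace_add subspace_scale subset_iff)
  ultimately have "card ((UNIV :: 'a set) \<times> U) \<le> card V"
    using fin by (rule card_inj_on_le)
  then have "(CARD('a) - 1) * card V \<le> CARD('a) * (card V - card U)"
    by (simp add: card_cartesian_product diff_mult_distrib diff_mult_distrib2)
  also have "card V - card U = card (V - U)"
    using U \<open>finite U\<close> by (simp add: card_Diff_subset)
  finally have "(CARD('a) + 1 - m) * ((CARD('a) - 1) * card V)
      \<le> (CARD('a) + 1 - m) * (CARD('a) * card (V - U))"
    by simp
  also have "\<dots> \<le> CARD('a) * (CARD('a) * card {v \<in> V. f v \<noteq> 0})"
    using mult_left_mono[OF main, of "CARD('a)"] by (simp add: mult_ac)
  finally show ?thesis
    by (simp add: power2_eq_square mult_ac)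
qed

section \<open>Coordinate vectors and kernels of linear forms\<close>

definition smul :: "'a::field \<Rightarrow> (nat \<Rightarrow> 'a) \<Rightarrow> nat \<Rightarrow> 'a" where
  "smul c v = (\<lambda>i. c * v i)"

interpretation smul: vector_space smul
  by standard (auto simp: smul_def fun_eq_iff algebra_simps)

definition dot :: "nat \<Rightarrow> (nat \<Rightarrow> 'a::field) \<Rightarrow> (nat \<Rightarrow> 'a) \<Rightarrow> 'a" where
  "dot n a v = (\<Sum>i\<le>n. a i * v i)"

lemma vector_space_mult: "vector_space ((*) :: 'a::field \<Rightarrow> 'a \<Rightarrow> 'a)"
  by standard (auto simp: algebra_simps)

lemma linear_dot: "Vector_Spaces.linear smul (*) (dot n a)"
  unfolding Vector_Spaces.linear_iff
  using smul.vector_space_axioms vector_space_mult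
  by (auto simp: dot_def smul_def algebra_simps sum.distrib sum_distrib_left)

lemma dot_smul: "dot n a (smul c v) = c * dot n a v"
  using linear_dot[of n a] by (simp add: Vector_Spaces.linear_iff)

lemma dot_0 [simp]: "dot n a 0 = 0"
  by (simp add: dot_def)

lemma subspace_pvecs: "smul.subspace (pvecs n)"
  by (auto simp: smul.subspace_def pvecs_def smul_def)

text \<open>The restriction to \<open>pvecs n\<close> keeps the set finite over a finite field, as
  \<open>dot n a\<close> ignores all coordinates beyond \<open>n\<close>.\<close>

definition ker :: "nat \<Rightarrow> (nat \<Rightarrow> 'a::field) \<Rightarrow> (nat \<Rightarrow> 'a) set" where
  "ker n a = {v \<in> pvecs n. dot n a v = 0}"

lemma subspace_ker: "smul.subspace (ker n a)"
  using linear_dot[of n a] subspace_pvecs[of n]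
  by (auto simp: smul.subspace_def ker_def Vector_Spaces.linear_iff)

lemma finite_pvecs: "finite (pvecs n :: (nat \<Rightarrow> 'a::{finite,field}) set)"
  by (rule finite_subset[OF _ finite_set_of_finite_funs[of "{..n}" "UNIV :: 'a set" 0]])
    (auto simp: pvecs_def not_le)

lemma card_pvecs: "card (pvecs n :: (nat \<Rightarrow> 'a::{finite,field}) set) = CARD('a) ^ (n + 1)"
proof -
  \<comment> \<open>Taking the coordinate \<open>v m\<close> as the linear form, with the unit
    vector as witness, splits off one factor \<open>CARD('a)\<close> per coordinate.\<close>
  have *: "card W = CARD('a) * card {v \<in> W. v m = 0}"
    if "smul.subspace W" "(\<lambda>i. if i = m then 1 else 0) \<in> W" for W :: "(nat \<Rightarrow> 'a) set" and m
  proof (rule card_subspace_kernel[OF _ that])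
    show "Vector_Spaces.linear smul (*) (\<lambda>v. v m)"
      unfolding Vector_Spaces.linear_iff
      using smul.vector_space_axioms vector_space_mult by (auto simp: smul_def)
  qed simp
  show ?thesis
  proof (induction n)
    case 0
    have "{v \<in> pvecs 0. v 0 = 0} = {0 :: nat \<Rightarrow> 'a}"
      by (auto simp: pvecs_def fun_eq_iff) (metis gr0I)
    then show ?case
      using *[of "pvecs 0" 0] by (simp add: subspace_pvecs) (simp add: pvecs_def)
  next
    case (Suc n)
    have "{v \<in> pvecs (Suc n). v (Suc n) = 0} = (pvecs n :: (nat \<Rightarrow> 'a) set)"
      by (auto simp: pvecs_def) (metis Suc_lessI)
    then show ?case
      using *[of "pvecs (Suc n)" "Suc n"] Suc by (simp add: subspace_pvecs) (simp add: pvecs_def)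
  qed
qed

lemma card_ker:
  fixes a :: "nat \<Rightarrow> 'a::{finite,field}"
  assumes "a \<in> pvecs n" "a \<noteq> 0"
  shows "card (ker n a) = CARD('a) ^ n"
proof -
  obtain m where m: "a m \<noteq> 0"
    using assms by (auto simp: fun_eq_iff)
  then have "m \<le> n"
    using assms by (auto simp: pvecs_def intro: leI)
  have "card (pvecs n :: (nat \<Rightarrow> 'a) set) = CARD('a) * card (ker n a)"
    unfolding ker_def
  proof (rule card_subspace_kernel[OF linear_dot subspace_pvecs])
    show "(\<lambda>i. if i = m then 1 else 0) \<in> pvecs n"
      using \<open>m \<le> n\<close> by (auto simp: pvecs_def)
    show "dot n a (\<lambda>i. if i = m then 1 else 0) \<noteq> 0"
      using \<open>m \<le> n\<close> m by (simp add: dot_def if_distrib cong: if_cong)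
  qed
  then show ?thesis
    by (simp add: card_pvecs)
qed

text \<open>Distinct kernels of equal finite size are not nested, so \<open>dot n b\<close> does not
  vanish on all of \<open>ker n a\<close>, and its kernel there has index
  \<open>CARD('a)\<close>.\<close>

lemma card_ker_Int_ker:
  fixes a b :: "nat \<Rightarrow> 'a::{finite,field}"
  assumes "a \<in> pvecs n" "a \<noteq> 0" "b \<in> pvecs n" "b \<noteq> 0" "ker n a \<noteq> ker n b" "n > 0"
  shows "card (ker n a \<inter> ker n b) = CARD('a) ^ (n - 1)"
proof -
  have "finite (ker n b)"
    unfolding ker_def by (rule finite_subset[OF _ finite_pvecs]) auto
  then have "\<not> ker n a \<subseteq> ker n b"
    using assms by (metis card_ker card_subset_eq)
  then obtain w where w: "w \<in> ker n a" "dot n b w \<noteq> 0"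
    by (auto simp: ker_def)
  have "CARD('a) ^ n = CARD('a) * card {v \<in> ker n a. dot n b v = 0}"
    using card_subspace_kernel[of smul "dot n b" "ker n a" w] linear_dot[of n b] subspace_ker[of n a] w assms
    by (simp add: card_ker)
  moreover have "{v \<in> ker n a. dot n b v = 0} = ker n a \<inter> ker n b"
    by (auto simp: ker_def)
  ultimately show ?thesis
    using \<open>n > 0\<close> by (cases n) auto
qed

section \<open>Points and hyperplanes of PG(n,q)\<close>

lemma pg_points_eq: "pg_points n = (\<lambda>v. range (\<lambda>c. smul c v)) ` (pvecs n - {0})"
  unfolding pg_points_def smul_def by (auto simp: full_SetCompr_eq zero_fun_def)

lemma finite_pg_points: "finite (pg_points n :: (nat \<Rightarrow> 'a::{finite,field}) set set)"
  unfolding pg_points_eq using finite_pvecs by blast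

text \<open>Points are lines through the origin; without \<open>0\<close> they are disjoint sets of
  \<open>CARD('a) - 1\<close> vectors. Cones rather than subspaces are treated because the support
  of a word is counted in this way too.\<close>

lemma card_points_in_cone:
  fixes T :: "(nat \<Rightarrow> 'a::{finite,field}) set"
  assumes T: "T \<subseteq> pvecs n" and cone: "\<And>c v. v \<in> T \<Longrightarrow> smul c v \<in> T"
  shows "card {P \<in> pg_points n. P \<subseteq> T} * (CARD('a) - 1) = card (T - {0})"
proof -
  let ?Q = "{P \<in> pg_points n. P \<subseteq> T}"
  let ?C = "(\<lambda>P. P - {0}) ` ?Q"
  have point: "\<exists>v. v \<in> pvecs n \<and> v \<noteq> 0 \<and> P = range (\<lambda>c. smul c v)" if "P \<in> ?Q" for P
    using that by (auto simp: pg_points_eq)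
  have sub: "P \<subseteq> Q" if PQ: "P \<in> ?Q" "Q \<in> ?Q" and x: "x \<in> P" "x \<in> Q" "x \<noteq> 0" for P Q x
  proof -
    obtain v w where v: "P = range (\<lambda>c. smul c v)" and w: "Q = range (\<lambda>c. smul c w)"
      using point[OF PQ(1)] point[OF PQ(2)] by blast
    obtain c d where c: "x = smul c v" and d: "x = smul d w"
      using x(1,2) unfolding v w by blast
    then have "c \<noteq> 0"
      using \<open>x \<noteq> 0\<close> by auto
    have "v = smul (1 / c) (smul c v)"
      using \<open>c \<noteq> 0\<close> by simp
    also have "\<dots> = smul (d / c) w"
      using d unfolding c by simp
    finally have "v = smul (d / c) w" .
    then show ?thesis
      unfolding v w by auto
  qed
  have zero: "0 \<in> P" if "P \<in> ?Q" for P
    using point[OF that] by (metis rangeI smul.scale_zero_left)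
  have "(CARD('a) - 1) * card ?C = card (\<Union>?C)"
  proof (rule card_partition)
    show "finite ?C"
      using finite_pg_points[where ?'a = 'a] by simp
    show "finite (\<Union>?C)"
      by (rule finite_subset[of _ T]) (use T finite_pvecs[of n] finite_subset in auto)
  next
    fix A assume "A \<in> ?C"
    then obtain P where P: "P \<in> ?Q" "A = P - {0}" by blast
    then obtain v where v: "v \<noteq> 0" "P = range (\<lambda>c. smul c v)"
      using point by metis
    have "inj (\<lambda>c. smul c v)"
      using v by (auto intro!: injI)
    then have "card P = CARD('a)"
      unfolding v by (simp add: card_image)
    then show "card A = CARD('a) - 1"
      using P zero by simp
  next
    fix A B assume AB: "A \<in> ?C" "B \<in> ?C" "A \<noteq> B"
    then obtain P Q where PQ: "P \<in> ?Q" "A = P - {0}" "Q \<in> ?Q" "B = Q - {0}"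
      by (elim imageE)
    show "A \<inter> B = {}"
    proof (rule ccontr)
      assume "A \<inter> B \<noteq> {}"
      then obtain x where "x \<in> P" "x \<in> Q" "x \<noteq> 0"
        using PQ by auto
      then have "P = Q"
        using sub[of P Q] sub[of Q P] PQ by blast
      with PQ AB show False by simp
    qed
  qed
  moreover have "card ?C = card ?Q"
    by (rule card_image) (use zero in \<open>auto simp: inj_on_def\<close>)
  moreover have "\<Union>?C = T - {0}"
  proof
    show "T - {0} \<subseteq> \<Union>?C"
    proof
      fix v assume v: "v \<in> T - {0}"
      have "range (\<lambda>c. smul c v) \<in> ?Q"
        using v T cone by (auto simp: pg_points_eq)
      moreover have "v \<in> range (\<lambda>c. smul c v)"
        by (metis rangeI smul.scale_one)
      ultimately show "v \<in> \<Union>?C"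
        using v by blast
    qed
  qed auto
  ultimately show ?thesis
    by (simp add: mult.commute)
qed


text \<open>With \<open>N\<close> points, \<open>N * (CARD('a) - 1) + 1 = card T\<close>. In the
  field both \<open>CARD('a)\<close> and \<open>card T\<close> become 0, which leaves
  \<open>1 - N = 0\<close>.\<close>

lemma of_nat_card_points_in_subspace:
  fixes T :: "(nat \<Rightarrow> 'a::{finite,field}) set"
  assumes T: "T \<subseteq> pvecs n" "smul.subspace T" and dvd: "CARD('a) dvd card T"
  shows "of_nat (card {P \<in> pg_points n. P \<subseteq> T}) = (1 :: 'a)"
proof -
  define N where "N = card {P \<in> pg_points n. P \<subseteq> T}"
  have "0 \<in> T" "finite T"
    using T finite_subset[OF _ finite_pvecs] by (auto simp: smul.subspace_0)
  then have "N * (CARD('a) - 1) + 1 = card T"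
    using card_points_in_cone[of T n] T card_Suc_Diff1[of T 0]
    by (simp add: N_def smul.subspace_scale)
  \<comment> \<open>Adding \<open>N\<close> on both sides removes the truncated subtraction before
    the passage to the field.\<close>
  moreover have "N * CARD('a) = N * (CARD('a) - 1) + N"
    by (metis add.commute finite_UNIV_card_ge_0 finite_class.finite_UNIV mult_eq_if mult.commute
        less_numeral_extra(3))
  ultimately have "N * CARD('a) + 1 = card T + N"
    by simp
  then have "of_nat (N * CARD('a) + 1) = (of_nat (card T + N) :: 'a)"
    by simp
  moreover have "of_nat (card T) = (0 :: 'a)"
    using dvd of_nat_card_eq_0[where ?'a = 'a] by (auto elim!: dvdE)
  ultimately show ?thesis
    using of_nat_card_eq_0[where ?'a = 'a] by (simp add: N_def)
qed

lemma pg_hyperplanes_eq: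
  "pg_hyperplanes n = {{P \<in> pg_points n. P \<subseteq> ker n a} | a. a \<in> pvecs n \<and> a \<noteq> 0}"
proof -
  have "{P \<in> pg_points n. \<forall>v\<in>P. (\<Sum>i\<le>n. a i * v i) = 0} = {P \<in> pg_points n. P \<subseteq> ker n a}"
    for a :: "nat \<Rightarrow> 'a"
    using subspace_pvecs[of n, where ?'a = 'a]
    by (auto simp: ker_def dot_def pg_points_eq subset_iff smul.subspace_scale)
  then show ?thesis
    by (simp add: pg_hyperplanes_def zero_fun_def)
qed

lemma finite_pg_hyperplanes: "finite (pg_hyperplanes n :: (nat \<Rightarrow> 'a::{finite,field}) set set set)"
  by (rule finite_subset[of _ "Pow (pg_points n)"])
    (auto simp: pg_hyperplanes_def finite_pg_points)

text \<open>The intersection contains \<open>CARD('a) ^ n\<close> or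
  \<open>CARD('a) ^ (n - 1)\<close> vectors, according to whether the hyperplanes coincide; as
  \<open>n \<ge> 2\<close>, both are divisible by \<open>CARD('a)\<close>. So scalar products do not
  distinguish equal from distinct hyperplanes.\<close>

lemma of_nat_card_hyperplane_Int:
  fixes H H' :: "(nat \<Rightarrow> 'a::{finite,field}) set set"
  assumes "n \<ge> 2" "H \<in> pg_hyperplanes n" "H' \<in> pg_hyperplanes n"
  shows "of_nat (card (H \<inter> H')) = (1 :: 'a)"
proof -
  obtain a b where a: "a \<in> pvecs n" "a \<noteq> 0" "H = {P \<in> pg_points n. P \<subseteq> ker n a}"
    and b: "b \<in> pvecs n" "b \<noteq> 0" "H' = {P \<in> pg_points n. P \<subseteq> ker n b}"
    using assms by (auto simp: pg_hyperplanes_eq)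
  have "H \<inter> H' = {P \<in> pg_points n. P \<subseteq> ker n a \<inter> ker n b}"
    using a b by auto
  moreover have "CARD('a) dvd card (ker n a \<inter> ker n b)"
    using a b assms(1)
    by (cases "ker n a = ker n b") (simp_all add: card_ker card_ker_Int_ker)
  ultimately show ?thesis
    using of_nat_card_points_in_subspace[of "ker n a \<inter> ker n b" n]
    by (simp add: smul.subspace_inter subspace_ker) (auto simp: ker_def)
qed

text \<open>With \<open>q = CARD('a)\<close>, the sizes of \<open>H\<close> and
  \<open>H \<inter> H'\<close> multiplied by \<open>q - 1\<close> are \<open>q ^ n - 1\<close> and
  \<open>q ^ (n - 1) - 1\<close>, with difference \<open>q ^ (n - 1) * (q - 1)\<close>.\<close>

lemma card_hyperplane_Diff:
  fixes H H' :: "(nat \<Rightarrow> 'a::{finite,field}) set set"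
  assumes "n > 0" "H \<in> pg_hyperplanes n" "H' \<in> pg_hyperplanes n" "H \<noteq> H'"
  shows "card (H - H') = CARD('a) ^ (n - 1)"
proof -
  obtain a b where a: "a \<in> pvecs n" "a \<noteq> 0" "H = {P \<in> pg_points n. P \<subseteq> ker n a}"
    and b: "b \<in> pvecs n" "b \<noteq> 0" "H' = {P \<in> pg_points n. P \<subseteq> ker n b}"
    using assms by (auto simp: pg_hyperplanes_eq)
  have "ker n a \<noteq> ker n b"
    using assms a b by auto
  then have ab: "card (ker n a \<inter> ker n b) = CARD('a) ^ (n - 1)"
    using a b assms by (simp add: card_ker_Int_ker)
  have count: "card {P \<in> pg_points n. P \<subseteq> T} * (CARD('a) - 1) = card T - 1"
    if "smul.subspace T" "T \<subseteq> pvecs n" for T :: "(nat \<Rightarrow> 'a) set"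
    using card_points_in_cone[of T n] that
    by (simp add: smul.subspace_scale smul.subspace_0 finite_subset[OF _ finite_pvecs])
  have sub: "smul.subspace (ker n a)" "ker n a \<subseteq> pvecs n"
    "smul.subspace (ker n a \<inter> ker n b)" "ker n a \<inter> ker n b \<subseteq> pvecs n"
    by (auto simp: subspace_ker smul.subspace_inter) (auto simp: ker_def)
  have HH': "H \<inter> H' = {P \<in> pg_points n. P \<subseteq> ker n a \<inter> ker n b}"
    using a b by auto
  have fin: "finite H" "finite H'"
    using a b finite_pg_points[of n, where ?'a = 'a] by simp_all
  have HH'_count: "card (H \<inter> H') * (CARD('a) - 1) = CARD('a) ^ (n - 1) - 1"
    unfolding HH' using count[OF sub(3,4)] ab by simp
  have H_count: "card H * (CARD('a) - 1) = CARD('a) ^ n - 1"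
    using count[OF sub(1,2)] a by (simp add: card_ker)
  have "card (H - H') * (CARD('a) - 1)
      = card H * (CARD('a) - 1) - card (H \<inter> H') * (CARD('a) - 1)"
    using fin by (simp add: card_Diff_subset_Int diff_mult_distrib)
  also have "\<dots> = (CARD('a) ^ n - 1) - (CARD('a) ^ (n - 1) - 1)"
    by (simp only: HH'_count H_count)
  also have "\<dots> = CARD('a) ^ n - CARD('a) ^ (n - 1)"
    by (simp add: Suc_leI)
  also have "\<dots> = CARD('a) ^ (n - 1) * (CARD('a) - 1)"
    using \<open>n > 0\<close> by (cases n) (simp_all add: diff_mult_distrib2 mult.commute)
  finally show ?thesis
    using card_UNIV_field_gt_1[where ?'a = 'a] by simp
qed


section \<open>Words as integer residues and their images in the field\<close>

text \<open>As \<open>p ^ h\<close> is zero in the field, the characteristic divides the prime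
  \<open>p\<close> and so equals it. Words have integer entries; this transfers congruences modulo
  \<open>p\<close> to equations in \<open>'a\<close>.\<close>

lemma of_int_field_eq_0_iff:
  assumes "prime p" "CARD('a::{finite,field}) = p ^ h"
  shows "of_int x = (0 :: 'a) \<longleftrightarrow> x mod int p = 0"
proof -
  have "of_nat p ^ h = (0 :: 'a)"
    using of_nat_card_eq_0[where ?'a = 'a] assms by simp
  then have "CHAR('a) dvd p"
    by (metis of_nat_eq_0_iff_char_dvd power_not_zero)
  then have "CHAR('a) = p"
    using assms CHAR_not_1[where ?'a = 'a] by (metis One_nat_def prime_nat_iff)
  then show ?thesis
    by (simp add: of_int_eq_0_iff_char_dvd mod_eq_0_iff_dvd)
qed

lemma of_int_mod_field:
  assumes "prime p" "CARD('a::{finite,field}) = p ^ h"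
  shows "of_int (x mod int p) = (of_int x :: 'a)"
proof -
  have "(x - x mod int p) mod int p = 0"
    by (simp add: mod_diff_right_eq)
  then have "of_int (x - x mod int p) = (0 :: 'a)"
    by (simp only: of_int_field_eq_0_iff[OF assms])
  then show ?thesis
    by simp
qed

lemma sum_incvec_mult:
  fixes H H' :: "(nat \<Rightarrow> 'a::{finite,field}) set set"
  assumes "H \<in> pg_hyperplanes n"
  shows "(\<Sum>P\<in>pg_points n. incvec n H P * incvec n H' P) = int (card (H \<inter> H'))"
proof -
  have "H \<subseteq> pg_points n"
    using assms by (auto simp: pg_hyperplanes_def)
  then have "(\<Sum>P\<in>pg_points n. incvec n H P * incvec n H' P) = (\<Sum>P\<in>H \<inter> H'. 1)"
    by (intro sum.mono_neutral_cong_right) (auto simp: finite_pg_points incvec_def)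
  then show ?thesis
    by simp
qed

lemma code_C_lincomb:
  fixes c :: "(nat \<Rightarrow> 'a::{finite,field}) set set \<Rightarrow> int"
  shows "(\<lambda>P. (\<Sum>H\<in>pg_hyperplanes n. c H * incvec n H P) mod int p) \<in> code_C p n"
  unfolding code_C_def by (auto intro!: exI[of _ c] simp: fun_eq_iff incvec_def)

lemma sum_of_bool_mult_incvec:
  fixes H :: "(nat \<Rightarrow> 'a::{finite,field}) set set"
  assumes "H \<in> pg_hyperplanes n"
  shows "(\<Sum>G\<in>pg_hyperplanes n. of_bool (G = H) * incvec n G P) = incvec n H P"
proof -
  have "(\<Sum>G\<in>pg_hyperplanes n. of_bool (G = H) * incvec n G P) = (\<Sum>G\<in>{H}. incvec n G P)"
    using assms finite_pg_hyperplanes by (intro sum.mono_neutral_cong_right) auto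
  then show ?thesis
    by simp
qed

lemma incvec_in_code_C:
  fixes H :: "(nat \<Rightarrow> 'a::{finite,field}) set set"
  assumes "H \<in> pg_hyperplanes n"
  shows "(\<lambda>P. incvec n H P mod int p) \<in> code_C p n"
  using code_C_lincomb[of "\<lambda>G. of_bool (G = H)" n p] sum_of_bool_mult_incvec[OF assms] by simp

section \<open>The intersection of the code with its dual\<close>

context
  fixes p h n :: nat
  assumes n: "n \<ge> 2" and p: "prime p" and card: "CARD('a::{finite,field}) = p ^ h"
begin

text \<open>Every \<open>card (H \<inter> H0)\<close> is 1 in the field, so the product of a word
  with a row does not depend on the row. Hence differences of rows are orthogonal to the code, and
  words of the hull have coefficient sum 0.\<close>

lemma of_int_sum_incvec_mult_lincomb:
  fixes c :: "(nat \<Rightarrow> 'a) set set \<Rightarrow> int" and H0 :: "(nat \<Rightarrow> 'a) set set"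
  assumes "H0 \<in> pg_hyperplanes n"
  shows "(\<Sum>P\<in>pg_points n. of_int (incvec n H0 P) *
      of_int ((\<Sum>H\<in>pg_hyperplanes n. c H * incvec n H P) mod int p))
    = (\<Sum>H\<in>pg_hyperplanes n. of_int (c H) :: 'a)"
proof -
  have "(\<Sum>P\<in>pg_points n. of_int (incvec n H0 P) *
      of_int ((\<Sum>H\<in>pg_hyperplanes n. c H * incvec n H P) mod int p))
    = (\<Sum>P\<in>pg_points n. \<Sum>H\<in>pg_hyperplanes n.
        (of_int (c H * (incvec n H0 P * incvec n H P)) :: 'a))"
    by (simp add: of_int_mod_field[OF p card] sum_distrib_left mult_ac)
  also have "\<dots> = (\<Sum>H\<in>pg_hyperplanes n.
      of_int (c H) * of_int (\<Sum>P\<in>pg_points n. incvec n H0 P * incvec n H P))"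
    by (subst sum.swap) (simp add: sum_distrib_left)
  also have "\<dots> = (\<Sum>H\<in>pg_hyperplanes n. of_int (c H))"
    using assms n by (intro sum.cong refl) (simp add: sum_incvec_mult of_nat_card_hyperplane_Int)
  finally show ?thesis .
qed

lemma incvec_diff_in_hull:
  fixes H1 H2 :: "(nat \<Rightarrow> 'a) set set"
  assumes H: "H1 \<in> pg_hyperplanes n" "H2 \<in> pg_hyperplanes n"
  shows "(\<lambda>P. (incvec n H1 P - incvec n H2 P) mod int p) \<in> code_C p n \<inter> code_dual p n"
    (is "?d \<in> _")
proof
  have "(\<Sum>G\<in>pg_hyperplanes n. (of_bool (G = H1) - of_bool (G = H2)) * incvec n G P)
      = incvec n H1 P - incvec n H2 P" for P
    using H by (simp only: left_diff_distrib sum_subtractf sum_of_bool_mult_incvec)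
  then show "?d \<in> code_C p n"
    using code_C_lincomb[of "\<lambda>G. of_bool (G = H1) - of_bool (G = H2)" n p] by simp
  show "?d \<in> code_dual p n"
    unfolding code_dual_def fp_vecs_def
  proof (safe, goal_cases)
    \<comment> \<open>Goal 4 is the orthogonality, where the equal products of \<open>H1\<close> and
      \<open>H2\<close> with \<open>g\<close> cancel; the other goals concern the support and the
      range of the entries.\<close>
    case (4 g)
    then obtain c where g: "g P = (\<Sum>H\<in>pg_hyperplanes n. c H * incvec n H P) mod int p"
      if "P \<in> pg_points n" for P
      by (auto simp: code_C_def)
    have "of_int (\<Sum>P\<in>pg_points n. ?d P * g P)
      = (\<Sum>P\<in>pg_points n. of_int (incvec n H1 P) *
          of_int ((\<Sum>H\<in>pg_hyperplanes n. c H * incvec n H P) mod int p) :: 'a)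
      - (\<Sum>P\<in>pg_points n. of_int (incvec n H2 P) *
          of_int ((\<Sum>H\<in>pg_hyperplanes n. c H * incvec n H P) mod int p))"
      by (simp add: g of_int_mod_field[OF p card] left_diff_distrib sum_subtractf)
    also have "\<dots> = 0"
      using H by (simp only: of_int_sum_incvec_mult_lincomb diff_self)
    finally show ?case
      by (simp only: of_int_field_eq_0_iff[OF p card])
  qed (use prime_gt_0_nat[OF p] in \<open>auto simp: incvec_def\<close>)
qed

lemma weight_incvec_diff:
  fixes H1 H2 :: "(nat \<Rightarrow> 'a) set set"
  assumes H: "H1 \<in> pg_hyperplanes n" "H2 \<in> pg_hyperplanes n" "H1 \<noteq> H2"
  shows "weight n (\<lambda>P. (incvec n H1 P - incvec n H2 P) mod int p) = 2 * CARD('a) ^ (n - 1)"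
proof -
  have sub: "H1 \<subseteq> pg_points n" "H2 \<subseteq> pg_points n"
    using H by (auto simp: pg_hyperplanes_def)
  \<comment> \<open>The entries on \<open>H2 - H1\<close> are \<open>-1\<close> reduced to
    \<open>p - 1\<close>, which stays nonzero for \<open>p = 2\<close>.\<close>
  have "1 mod int p = 1" "-1 mod int p \<noteq> 0"
    using prime_gt_1_nat[OF p] by (auto simp: zmod_minus1)
  then have "{P \<in> pg_points n. (incvec n H1 P - incvec n H2 P) mod int p \<noteq> 0}
      = (H1 - H2) \<union> (H2 - H1)"
    using sub by (auto simp: incvec_def)
  moreover have "card ((H1 - H2) \<union> (H2 - H1)) = card (H1 - H2) + card (H2 - H1)"
    using sub finite_pg_points[of n, where ?'a = 'a]
    by (intro card_Un_disjoint) (auto intro: finite_subset)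
  ultimately show ?thesis
    using card_hyperplane_Diff[of n H1 H2] card_hyperplane_Diff[of n H2 H1] H n
    by (simp add: weight_def)
qed

lemma weight_hull_ge:
  fixes f :: "(nat \<Rightarrow> 'a) set \<Rightarrow> int"
  assumes f: "f \<in> code_C p n" "f \<in> code_dual p n" "f \<noteq> (\<lambda>_. 0)"
  shows "2 * CARD('a) ^ (n - 1) \<le> weight n f"
proof -
  let ?q = "CARD('a)"
  let ?Hs = "pg_hyperplanes n :: (nat \<Rightarrow> 'a) set set set"
  have q: "?q > 1"
    by (rule card_UNIV_field_gt_1)
  obtain c where c: "\<And>P. f P = (if P \<in> pg_points n
      then (\<Sum>H\<in>?Hs. c H * incvec n H P) mod int p else 0)"
    using f(1) by (auto simp: code_C_def)
  \<comment> \<open>Any hyperplane serves as the test row; this one consists of the points with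
    coordinate 0 equal to zero.\<close>
  define H0 :: "(nat \<Rightarrow> 'a) set set" where
    "H0 = {P \<in> pg_points n. P \<subseteq> ker n (\<lambda>i. if i = 0 then 1 else 0)}"
  have H0: "H0 \<in> ?Hs"
    unfolding pg_hyperplanes_eq H0_def
    by (intro CollectI exI[of _ "\<lambda>i. if i = 0 then 1 else 0"]) (auto simp: pvecs_def fun_eq_iff)
  have "(\<Sum>H\<in>?Hs. of_int (c H) :: 'a) = (\<Sum>P\<in>pg_points n. of_int (incvec n H0 P) *
      of_int ((\<Sum>H\<in>?Hs. c H * incvec n H P) mod int p))"
    by (rule of_int_sum_incvec_mult_lincomb[OF H0, symmetric])
  also have "\<dots> = of_int (\<Sum>P\<in>pg_points n. f P * (incvec n H0 P mod int p))"
    by (simp add: c of_int_mod_field[OF p card] mult.commute)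
  also have "\<dots> = 0"
    unfolding of_int_field_eq_0_iff[OF p card]
    using f(2) incvec_in_code_C[OF H0] by (simp add: code_dual_def)
  finally have sum_c: "(\<Sum>H\<in>?Hs. of_int (c H) :: 'a) = 0" .

  have "\<forall>H\<in>?Hs. \<exists>a. H = {P \<in> pg_points n. P \<subseteq> ker n a}"
    by (auto simp: pg_hyperplanes_eq)
  then obtain a where a: "\<And>H. H \<in> ?Hs \<Longrightarrow> H = {P \<in> pg_points n. P \<subseteq> ker n (a H)}"
    by metis
  \<comment> \<open>\<open>F\<close> collects the powers from the incidence functions
    \<open>1 - dot n (a H) v ^ (?q - 1)\<close>. The constants 1 contribute the coefficient sum,
    which is 0 by \<open>sum_c\<close>, so the word is given by \<open>- F\<close>.\<close>
  define F where "F = (\<lambda>v. \<Sum>H\<in>?Hs. of_int (c H) * dot n (a H) v ^ (?q - 1))"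
  have F_scale: "F (smul t v) = t ^ (?q - 1) * F v" for t v
    by (simp add: F_def dot_smul power_mult_distrib sum_distrib_left mult_ac)
  have F_0: "F 0 = 0"
    using q by (simp add: F_def power_0_left)
  have F_f: "F v = - of_int (f (range (\<lambda>t. smul t v)))" if v: "v \<in> pvecs n" "v \<noteq> 0" for v
  proof -
    have P: "range (\<lambda>t. smul t v) \<in> pg_points n"
      using v by (auto simp: pg_points_eq)
    have inc: "of_int (incvec n H (range (\<lambda>t. smul t v))) = 1 - dot n (a H) v ^ (?q - 1)"
      if H: "H \<in> ?Hs" for H
    proof -
      have "range (\<lambda>t. smul t v) \<in> H \<longleftrightarrow> range (\<lambda>t. smul t v) \<subseteq> ker n (a H)"
        using P by (subst a[OF H]) simp
      also have "\<dots> \<longleftrightarrow> v \<in> ker n (a H)"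
      proof
        assume "range (\<lambda>t. smul t v) \<subseteq> ker n (a H)"
        then have "smul 1 v \<in> ker n (a H)"
          by blast
        then show "v \<in> ker n (a H)"
          by simp
      qed (auto intro: smul.subspace_scale[OF subspace_ker])
      also have "\<dots> \<longleftrightarrow> dot n (a H) v = 0"
        using v by (simp add: ker_def)
      finally show ?thesis
        using P q power_card_minus_one[of "dot n (a H) v"]
        by (auto simp: incvec_def power_0_left)
    qed
    have "of_int (f (range (\<lambda>t. smul t v)))
        = (\<Sum>H\<in>?Hs. of_int (c H) * (1 - dot n (a H) v ^ (?q - 1)))"
      using P by (simp add: c of_int_mod_field[OF p card] inc)
    also have "\<dots> = - F v"
      using sum_c by (simp add: F_def right_diff_distrib sum_subtractf)
    finally show ?thesis
      by simp
  qed
  \<comment> \<open>The entries of \<open>f\<close> are already reduced modulo \<open>p\<close>, so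
    a nonzero entry stays nonzero in the field.\<close>
  have f_eq_0: "of_int (f P) = (0 :: 'a) \<longleftrightarrow> f P = 0" for P
    unfolding of_int_field_eq_0_iff[OF p card] by (subst (1 2) c) simp

  obtain P where "f P \<noteq> 0"
    using f(3) by auto
  then have "P \<in> pg_points n"
    using c by metis
  then obtain v where v: "v \<in> pvecs n" "v \<noteq> 0" "P = range (\<lambda>t. smul t v)"
    by (auto simp: pg_points_eq)
  have "F v \<noteq> 0"
    using F_f v \<open>f P \<noteq> 0\<close> f_eq_0 by simp
  define X where "X = {v \<in> pvecs n. F v \<noteq> 0}"
  \<comment> \<open>In degree \<open>?q - 1\<close> the first factor of the bound is 2: this is the
    source of the 2 in the minimum weight.\<close>
  have "(?q + 1 - (?q - 1)) * ((?q - 1) * card (pvecs n :: (nat \<Rightarrow> 'a) set)) \<le> ?q\<^sup>2 * card X"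
    unfolding X_def F_def
  proof (rule card_nonzeros_form[where s = smul])
    show "(\<Sum>H\<in>?Hs. of_int (c H) * dot n (a H) v ^ (?q - 1)) \<noteq> 0"
      using \<open>F v \<noteq> 0\<close> by (simp add: F_def)
  qed (use q v in \<open>auto simp: smul.vector_space_axioms finite_pg_hyperplanes linear_dot
      subspace_pvecs finite_pvecs\<close>)
  then have bound: "2 * ((?q - 1) * ?q ^ (n + 1)) \<le> ?q\<^sup>2 * card X"
    using q by (simp add: card_pvecs)
  have weight: "weight n f * (?q - 1) = card X"
  proof -
    \<comment> \<open>The vector \<open>0\<close> is added because every point contains it, whereas
      \<open>F 0 = 0\<close> keeps it out of \<open>X\<close>.\<close>
    have "{P \<in> pg_points n. P \<subseteq> insert 0 X} = {P \<in> pg_points n. f P \<noteq> 0}"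
    proof -
      have "range (\<lambda>t. smul t v) \<subseteq> insert 0 X \<longleftrightarrow> f (range (\<lambda>t. smul t v)) \<noteq> 0"
        if v: "v \<in> pvecs n" "v \<noteq> 0" for v
      proof -
        have "range (\<lambda>t. smul t v) \<subseteq> insert 0 X \<longleftrightarrow> F v \<noteq> 0"
        proof
          assume "range (\<lambda>t. smul t v) \<subseteq> insert 0 X"
          then have "smul 1 v \<in> insert 0 X"
            by blast
          then show "F v \<noteq> 0"
            using v by (simp add: X_def)
        next
          assume "F v \<noteq> 0"
          then show "range (\<lambda>t. smul t v) \<subseteq> insert 0 X"
            using v subspace_pvecs[of n, where ?'a = 'a] by (auto simp: X_def F_scale smul.subspace_scale)
        qed
        then show ?thesis
          using F_f[OF v] f_eq_0 by simp
      qed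
      then show ?thesis
        by (auto simp: pg_points_eq)
    qed
    moreover have "smul t v \<in> insert 0 X" if "v \<in> insert 0 X" for t v
      using that subspace_pvecs[of n, where ?'a = 'a] by (auto simp: X_def F_scale smul.subspace_scale)
    moreover have "insert 0 X \<subseteq> pvecs n"
      using subspace_pvecs[of n, where ?'a = 'a] by (auto simp: X_def smul.subspace_0)
    moreover have "insert 0 X - {0} = X"
      using F_0 by (auto simp: X_def)
    ultimately show ?thesis
      using card_points_in_cone[of "insert 0 X" n] by (simp add: weight_def)
  qed
  have power: "?q ^ (n + 1) = ?q\<^sup>2 * ?q ^ (n - 1)"
    using n by (simp flip: power_add)
  \<comment> \<open>Both sides of the bound are brought to the common positive factor
    \<open>?q\<^sup>2 * (?q - 1)\<close>, which then cancels.\<close>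
  have "(?q\<^sup>2 * (?q - 1)) * (2 * ?q ^ (n - 1)) = 2 * ((?q - 1) * ?q ^ (n + 1))"
    unfolding power by (simp only: mult_ac)
  also note bound
  also have "?q\<^sup>2 * card X = (?q\<^sup>2 * (?q - 1)) * weight n f"
    unfolding weight[symmetric] by (simp only: mult_ac)
  finally show ?thesis
    using q by (subst (asm) mult_le_cancel1) simp
qed

end

theorem mainTheorem1:
  fixes n p h :: nat
  assumes "n \<ge> 2" and "prime p" and "h \<ge> 1"
    and "card (UNIV :: 'a::{finite,field} set) = p ^ h"
  shows "(\<forall>f \<in> code_C p n \<inter> code_dual p n.
            f \<noteq> (\<lambda>_. 0) \<longrightarrow> 2 * (p ^ h) ^ (n - 1) \<le> weight n (f :: (nat \<Rightarrow> 'a) set \<Rightarrow> int))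
       \<and> (\<forall>H1 \<in> (pg_hyperplanes n :: (nat \<Rightarrow> 'a) set set set). \<forall>H2 \<in> pg_hyperplanes n. H1 \<noteq> H2 \<longrightarrow>
            (let d = (\<lambda>P. (incvec n H1 P - incvec n H2 P) mod int p) in
               d \<in> code_C p n \<inter> code_dual p n \<and> weight n d = 2 * (p ^ h) ^ (n - 1)))"
  unfolding Let_def assms(4)[symmetric]
  using weight_hull_ge[OF assms(1,2,4)] incvec_diff_in_hull[OF assms(1,2,4)]
    weight_incvec_diff[OF assms(1,2,4)]
  by blast

end
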